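(* Let $N\ge 1$, let $\mathcal{N}_i\subset\{1,\dots,N\}$ ($1\le i\le N$) be the neighbor sets of a digraph that contains a spanning tree, let $\Omega_1,\dots,\Omega_N\in\mathbb{R}$ be natural frequencies, let $\theta_{10},\dots,\theta_{N0}\in\mathbb{R}$ be initial phases with $$D(\theta(0))=\max_{i}\theta_{i0}-\min_i\theta_{i0}<\pi ,$$ and let $D^\infty$ be a given constant with $0<D^\infty<\frac{\pi}{2}$. Then for all sufficiently large coupling strength $K$ and all sufficiently small frustration $\alpha$ (that is, there exist $K_0>0$ and $\alpha_0\in(0,\frac{\pi}{2})$, depending on $N$, the neighbor sets $\mathcal{N}_1,\dots,\mathcal{N}_N$, the natural frequencies $\Omega_1,\dots,\Omega_N$, the initial phases $\theta_{10},\dots,\theta_{N0}$ and the constant $D^\infty$, such that for all $K>K_0$ and all $\alpha\in(0,\alpha_0)$), the solution $\theta=(\theta_1,\dots,\theta_N)$ of $$\dot\theta_i(t)=\Omega_i+K\sum_{j\in\mathcal{N}_i}\sin(\theta_j(t)-\theta_i(t)+\alpha),\quad t>0,\qquad \theta_i(0)=\theta_{i0},\qquad i=1,\dots,N,$$ has the following property: there exists a finite time $t_*>0$ such that $$D(\theta(t))\le D^\infty\qquad\text{for all } t\in[t_*,\infty).$$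
   Context: The network is the digraph with vertex set $\{1,\dots,N\}$ and an arc $(j,i)$ exactly when $j\in\mathcal{N}_i$ (oscillator $j$ influences oscillator $i$; equivalently the $(0,1)$-adjacency entry $\chi_{ij}$ equals $1$). A path from $i_1$ to $i_k$ is a sequence $i_1,\dots,i_k$ with $i_s\in\mathcal{N}_{i_{s+1}}$ for $1\le s\le k-1$; vertex $i$ is reachable from $j$ if there is a path from $j$ to $i$. The digraph contains a spanning tree if there is a vertex from which every other vertex is reachable. The phase diameter is $D(\theta(t))=\max_{1\le i\le N}\theta_i(t)-\min_{1\le i\le N}\theta_i(t)$. Phases are real-valued (not taken modulo $2\pi$). *)

theory Defs
  imports Complex_Main
begin

text \<open>
  Vertices are the naturals in \<open>{1..N}\<close>; a digraph is given by its neighbor sets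
  \<open>Nb i\<close>, where \<open>j \<in> Nb i\<close> is the arc from \<open>j\<close> to \<open>i\<close> (\<open>j\<close> influences \<open>i\<close>).
  All data indexed by vertices are total functions on \<^typ>\<open>nat\<close>, and only their values on
  \<open>{1..N}\<close> are used.
\<close>

definition is_path :: "nat \<Rightarrow> (nat \<Rightarrow> nat set) \<Rightarrow> nat list \<Rightarrow> bool" where
  "is_path N Nb p \<longleftrightarrow>
     p \<noteq> [] \<and> set p \<subseteq> {1..N} \<and> successively (\<lambda>j i. j \<in> Nb i) p"

definition reachable_from :: "nat \<Rightarrow> (nat \<Rightarrow> nat set) \<Rightarrow> nat \<Rightarrow> nat \<Rightarrow> bool" where
  "reachable_from N Nb j i \<longleftrightarrow> (\<exists>p. is_path N Nb p \<and> hd p = j \<and> last p = i)"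

definition contains_spanning_tree :: "nat \<Rightarrow> (nat \<Rightarrow> nat set) \<Rightarrow> bool" where
  "contains_spanning_tree N Nb \<longleftrightarrow>
     (\<exists>r\<in>{1..N}. \<forall>i\<in>{1..N} - {r}. reachable_from N Nb r i)"

definition phase_diameter :: "nat \<Rightarrow> (nat \<Rightarrow> real) \<Rightarrow> real" where
  "phase_diameter N x = Max (x ` {1..N}) - Min (x ` {1..N})"

text \<open>
  Here \<open>\<theta> t i\<close> is the phase of oscillator \<open>i\<close> at time \<open>t\<close>. The differential equation is
  imposed for \<open>t > 0\<close> only; continuity on \<open>{0..}\<close> ties the trajectory to its initial value.
  Values of \<open>\<theta>\<close> at negative times are irrelevant.
\<close>

definition kuramoto_solution ::
  "nat \<Rightarrow> (nat \<Rightarrow> nat set) \<Rightarrow> (nat \<Rightarrow> real) \<Rightarrow> (nat \<Rightarrow> real) \<Rightarrow> real \<Rightarrow> real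
     \<Rightarrow> (real \<Rightarrow> nat \<Rightarrow> real) \<Rightarrow> bool" where
  "kuramoto_solution N Nb \<Omega> \<theta>0 K \<alpha> \<theta> \<longleftrightarrow>
     (\<forall>i\<in>{1..N}.
        \<theta> 0 i = \<theta>0 i \<and>
        continuous_on {0..} (\<lambda>t. \<theta> t i) \<and>
        (\<forall>t>0. ((\<lambda>s. \<theta> s i) has_real_derivative
                  \<Omega> i + K * (\<Sum>j\<in>Nb i. sin (\<theta> t j - \<theta> t i + \<alpha>))) (at t)))"

end

theory Submission
  imports Defs "HOL-Analysis.Analysis"
begin

text \<open>
  In the time unit \<open>1 / K\<close> the equation becomes \<open>x' i = (\<Sum>j\<in>Nb i. sin (x j - x i)) + e i\<close> with
  \<open>\<bar>e i\<bar> \<le> (\<Sum>i. \<bar>\<Omega> i\<bar>) / K + N * \<alpha>\<close>, because \<open>sin\<close> is \<open>1\<close>-Lipschitz. So a large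
  coupling and a small frustration make the system an arbitrarily small perturbation of plain sine
  coupling (lemma \<open>kuramoto_rescaled\<close>), and it remains to show that sine coupling contracts at
  a definite rate.

  The spread of the phases is measured by a radius \<open>R\<close> about some center \<open>\<mu>\<close>. As long as
  \<open>2 * R < pi\<close>, a phase on the boundary of the interval around \<open>\<mu>\<close> is not pushed outward by any
  neighbor, so the interval grows no faster than the error bound \<open>\<epsilon>\<close> (lemma
  \<open>confinement\<close>). The interval need not shrink at once, since an extreme vertex may have
  neighbors at the same phase, or none at all. What moves it is the root of the spanning tree.
  By reflection the root may be assumed to lie in the upper half, hence at
  height at least \<open>R\<close> above the lower end. The root loses height at most exponentially, it lifts
  its successors, these lift theirs, and after one unit of time every vertex lies a fixed fraction of
  \<open>R\<close> above the lower end (lemma \<open>influence_spreads\<close>). Hence each time unit replaces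
  \<open>R\<close> by \<open>(1 - c) * R + \<epsilon>\<close>, where \<open>c > 0\<close> depends only on the graph and on the bound
  \<open>b < pi\<close> for the phase differences (lemma \<open>contraction_step\<close>).

  If \<open>\<epsilon> \<le> c * R\<close> for the initial radius, the radius never exceeds its initial value, so the bound
  \<open>b\<close> stays valid and the step can be iterated; the radii then fall below any number larger
  than \<open>\<epsilon> / c\<close>, which is small with \<open>\<epsilon>\<close> (lemma \<open>eventually_confined\<close>).
\<close>

section \<open>Comparison tools\<close>

text \<open>
  At the first time when some \<open>f i\<close> reaches zero, all the others are still nonpositive, so
  \<open>f i\<close> has a negative derivative there and was positive just before, a contradiction. Having finitely many
  functions guarantees that there is a first such time.
\<close>

lemma barrier_not_crossed:
  fixes f :: "'i \<Rightarrow> real \<Rightarrow> real"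
  assumes fin: "finite I"
    and cont: "\<And>i. i \<in> I \<Longrightarrow> continuous_on {a..b} (f i)"
    and start: "\<And>i. i \<in> I \<Longrightarrow> f i a < 0"
    and inward: "\<And>i t. \<lbrakk>i \<in> I; a < t; t \<le> b; \<And>j. j \<in> I \<Longrightarrow> f j t \<le> 0; f i t = 0\<rbrakk>
                   \<Longrightarrow> \<exists>d<0. (f i has_real_derivative d) (at t)"
    and "i \<in> I" "t \<in> {a..b}"
  shows "f i t < 0"
proof (rule ccontr)
  assume "\<not> f i t < 0"
  define S where "S = (\<Union>i\<in>I. {t \<in> {a..b}. 0 \<le> f i t})"
  have "closed {t \<in> {a..b}. 0 \<le> f i t}" if "i \<in> I" for i
  proof -
    have "{t \<in> {a..b}. 0 \<le> f i t} = {a..b} \<inter> f i -` {0..}" by auto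
    then show ?thesis
      using continuous_closed_preimage[OF cont[OF that], of "{0..}"] by simp
  qed
  then have "closed S" using fin unfolding S_def by (intro closed_UN) auto
  moreover have "S \<noteq> {}" using \<open>i \<in> I\<close> \<open>t \<in> {a..b}\<close> \<open>\<not> f i t < 0\<close> by (auto simp: S_def not_less)
  moreover have "bdd_below S" by (auto simp: S_def bdd_below_def)
  ultimately have "Inf S \<in> S" using closed_contains_Inf by blast
  define t1 where "t1 = Inf S"
  have before: "f j s < 0" if "j \<in> I" "a \<le> s" "s < t1" for j s
  proof (rule ccontr)
    assume "\<not> f j s < 0"
    moreover have "t1 \<le> b" using \<open>Inf S \<in> S\<close> by (auto simp: t1_def S_def)
    ultimately have "s \<in> {t \<in> {a..b}. 0 \<le> f j t}" using that by simp
    then have "s \<in> S" unfolding S_def using \<open>j \<in> I\<close> by blast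
    then have "t1 \<le> s" unfolding t1_def using \<open>bdd_below S\<close> by (rule cInf_lower)
    then show False using that by simp
  qed
  obtain k where k: "k \<in> I" "t1 \<in> {a..b}" "0 \<le> f k t1"
    using \<open>Inf S \<in> S\<close> by (auto simp: S_def t1_def)
  have "a < t1" using k start[of k] by (cases "t1 = a") auto
  have le: "f j t1 \<le> 0" if j: "j \<in> I" for j
  proof (rule ccontr)
    assume "\<not> f j t1 \<le> 0"
    moreover have "continuous_on {a..t1} (f j)"
      using cont[OF j] by (rule continuous_on_subset) (use k in auto)
    ultimately obtain s where "a \<le> s" "s \<le> t1" "f j s = 0"
      using IVT'[of "f j" a 0 t1] start[OF j] \<open>a < t1\<close> by auto
    then show False using before[OF j, of s] \<open>\<not> f j t1 \<le> 0\<close> by (cases "s = t1") auto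
  qed
  then have "f k t1 = 0" using k by (simp add: antisym)
  then obtain d where "d < 0" "(f k has_real_derivative d) (at t1)"
    using inward[of k t1] k le \<open>a < t1\<close> by auto
  then obtain h where h: "h > 0" "\<And>e. 0 < e \<Longrightarrow> e < h \<Longrightarrow> f k t1 < f k (t1 - e)"
    using DERIV_neg_dec_left by blast
  define e where "e = min (h/2) (t1 - a)"
  have "0 < e" "e < h" "e \<le> t1 - a" using h(1) \<open>a < t1\<close> by (auto simp: e_def min_def)
  then show False using h(2)[of e] before[OF k(1), of "t1 - e"] \<open>f k t1 = 0\<close> by auto
qed

text \<open>
  Turns sine coupling into linear coupling of strength \<open>sin b / b\<close>, which is positive exactly
  because \<open>b < pi\<close>.
\<close>

lemma sin_above_chord:
  fixes b z :: real
  assumes "0 < b" "b \<le> pi" "0 \<le> z" "z \<le> b"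
  shows "sin b / b * z \<le> sin z"
proof -
  have "concave_on {0..pi} sin"
    by (rule f''_le0_imp_concave[where f' = cos and f'' = "\<lambda>x. - sin x"])
       (auto intro!: derivative_eq_intros sin_ge_zero)
  then have "(1 - z/b) * sin 0 + (z/b) * sin b \<le> sin ((1 - z/b) *\<^sub>R 0 + (z/b) *\<^sub>R b)"
    using assms by (intro concave_onD) auto
  then show ?thesis using assms by (simp add: mult.commute)
qed

lemma abs_sin_shift_le: "\<bar>sin (z + h) - sin z\<bar> \<le> \<bar>h\<bar>" for z h :: real
proof -
  have "\<bar>sin (z + h) - sin z\<bar> = 2 * \<bar>sin (h/2)\<bar> * \<bar>cos ((z + h + z)/2)\<bar>"
    by (simp add: sin_diff_sin abs_mult)
  also have "\<dots> \<le> 2 * \<bar>h/2\<bar> * 1"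
    by (intro mult_mono abs_sin_x_le_abs_x) auto
  finally show ?thesis by simp
qed

section \<open>Perturbed sine coupling\<close>

definition arcs :: "'v set \<Rightarrow> ('v \<Rightarrow> 'v set) \<Rightarrow> ('v \<times> 'v) set" where
  "arcs V Nb = {(j, i). i \<in> V \<and> j \<in> Nb i}"

text \<open>
  A unit of time shrinks the spread of \<open>n\<close> phases by the factor
  \<open>1 - contraction_rate n b L\<close>, up to the perturbation, when all phase differences stay below
  \<open>b\<close> and all vertices lie within \<open>L\<close> arcs of a root. The three factors are the strength
  \<open>sin b / b\<close> of the coupling along each of \<open>L\<close> arcs, the time simplex \<open>1 / L!\<close> over which
  the influence is integrated, and the loss \<open>exp (- n)\<close> to the at most \<open>n\<close> neighbors of a
  vertex; halving accounts for the fact that the diameter is twice the radius.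
\<close>

definition contraction_rate :: "nat \<Rightarrow> real \<Rightarrow> nat \<Rightarrow> real" where
  "contraction_rate n b L = (sin b / b) ^ L / fact L * exp (- real n) / 2"

lemma contraction_rate_bounds:
  assumes "0 < b" "b < pi"
  shows "0 < contraction_rate n b L" "contraction_rate n b L < 1"
proof -
  have a: "0 < sin b / b" "sin b / b \<le> 1"
    using assms sin_gt_zero sin_x_le_x[of b] by auto
  then show "0 < contraction_rate n b L" by (simp add: contraction_rate_def)
  have "(sin b / b) ^ L / fact L * exp (- real n) \<le> 1 / 1 * 1"
    using a by (intro mult_mono frac_le power_le_one) auto
  then have "contraction_rate n b L \<le> 1 / 2"
    unfolding contraction_rate_def by (intro divide_right_mono) simp_all
  then show "contraction_rate n b L < 1" by simp
qed

text \<open>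
  The error term is only required to be bounded, at each vertex and time separately. This class
  of flows is closed under reflecting all phases, which the system with a fixed frustration is
  not.
\<close>

locale perturbed_flow =
  fixes V :: "'v set" and Nb :: "'v \<Rightarrow> 'v set" and \<epsilon> :: real and x :: "real \<Rightarrow> 'v \<Rightarrow> real"
  assumes finite_V: "finite V"
    and Nb_sub: "i \<in> V \<Longrightarrow> Nb i \<subseteq> V"
    and eps_nonneg: "0 \<le> \<epsilon>"
    and cont: "i \<in> V \<Longrightarrow> continuous_on {0..} (\<lambda>t. x t i)"
    and deriv: "\<lbrakk>i \<in> V; 0 < t\<rbrakk> \<Longrightarrow> \<exists>e. \<bar>e\<bar> \<le> \<epsilon> \<and>
        ((\<lambda>s. x s i) has_real_derivative (\<Sum>j\<in>Nb i. sin (x t j - x t i)) + e) (at t)"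
begin

lemma reflected: "perturbed_flow V Nb \<epsilon> (\<lambda>t i. - x t i)"
proof
  fix i t assume "i \<in> V" "0 < (t::real)"
  then obtain e where e: "\<bar>e\<bar> \<le> \<epsilon>"
    "((\<lambda>s. x s i) has_real_derivative (\<Sum>j\<in>Nb i. sin (x t j - x t i)) + e) (at t)"
    using deriv by blast
  have "(\<Sum>j\<in>Nb i. sin (- x t j - - x t i)) = - (\<Sum>j\<in>Nb i. sin (x t j - x t i))"
    unfolding sum_negf[symmetric] by (intro sum.cong refl) (simp flip: sin_minus)
  then have "((\<lambda>s. - x s i) has_real_derivative
      (\<Sum>j\<in>Nb i. sin (- x t j - - x t i)) + - e) (at t)"
    using DERIV_minus[OF e(2)] by simp
  with e(1) show "\<exists>e. \<bar>e\<bar> \<le> \<epsilon> \<and> ((\<lambda>s. - x s i) has_real_derivative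
      (\<Sum>j\<in>Nb i. sin (- x t j - - x t i)) + e) (at t)"
    by (intro exI[of _ "-e"]) simp
qed (auto intro: finite_V Nb_sub eps_nonneg cont continuous_intros dest: subsetD[OF Nb_sub])

text \<open>
  With \<open>2 * (R + \<epsilon>) < pi\<close>, no phase can leave the growing interval first: at the moment of leaving
  it is an extreme phase, so its neighbors lie on the inner side at distances below \<open>pi\<close>. The
  coupling then does not push it outward, and its outward speed is at most \<open>\<epsilon>\<close>.
\<close>

lemma confinement:
  assumes t0: "0 \<le> t0" and R: "2 * (R + \<epsilon>) < pi"
    and start: "\<And>i. i \<in> V \<Longrightarrow> \<bar>x t0 i - \<mu>\<bar> \<le> R"
    and s: "0 \<le> s" "s \<le> 1" and i: "i \<in> V"
  shows "\<bar>x (t0 + s) i - \<mu>\<bar> \<le> R + \<epsilon> * s"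
proof -
  \<comment> \<open>The barrier argument needs strict inequalities, so the interval is widened by \<open>\<eta>\<close> and
      made to grow faster by \<open>\<eta>\<close>; the bound on \<open>\<eta>\<close> keeps its length below \<open>pi\<close>.\<close>
  have strict: "\<bar>x (t0 + s) i - \<mu>\<bar> < R + \<eta> + (\<epsilon> + \<eta>) * s" if \<eta>: "0 < \<eta>" "\<eta> < (pi - 2 * (R + \<epsilon>)) / 4" for \<eta>
  proof -
    \<comment> \<open>The sign \<open>\<sigma>\<close> selects the upper or the lower end of the interval.\<close>
    define f where "f = (\<lambda>(i, \<sigma>) t. \<sigma> * (x t i - \<mu>) - (R + \<eta> + (\<epsilon> + \<eta>) * (t - t0)))"
    have main: "f k t < 0" if "k \<in> V \<times> {1, -1}" "t \<in> {t0..t0 + 1}" for k t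
    proof (rule barrier_not_crossed[OF _ _ _ _ that])
      show "finite (V \<times> {1, -1::real})" using finite_V by simp
      show "continuous_on {t0..t0 + 1} (f k)" if "k \<in> V \<times> {1, -1}" for k
      proof -
        have "continuous_on {t0..t0+1} (\<lambda>t. x t (fst k))"
          using cont[of "fst k"] by (rule continuous_on_subset) (use that t0 in auto)
        then show ?thesis unfolding f_def by (cases k) (auto intro!: continuous_intros)
      qed
      show "f k t0 < 0" if "k \<in> V \<times> {1, -1}" for k
        using that start[of "fst k"] \<eta> by (auto simp: f_def abs_le_iff)
      fix k t
      assume k: "k \<in> V \<times> {1, -1}" and t: "t0 < t" "t \<le> t0 + 1"
        and inside: "\<And>j. j \<in> V \<times> {1, -1} \<Longrightarrow> f j t \<le> 0" and hit: "f k t = 0"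
      obtain l \<sigma> where kl: "k = (l, \<sigma>)" "l \<in> V" "\<sigma> \<in> {1, -1}" using k by auto
      define \<rho> where "\<rho> = R + \<eta> + (\<epsilon> + \<eta>) * (t - t0)"
      have "(\<epsilon> + \<eta>) * (t - t0) \<le> (\<epsilon> + \<eta>) * 1"
        using t \<eta> eps_nonneg by (intro mult_left_mono) auto
      then have \<rho>: "2 * \<rho> < pi" using \<eta> by (simp add: \<rho>_def)
      obtain e where e: "\<bar>e\<bar> \<le> \<epsilon>"
        "((\<lambda>s. x s l) has_real_derivative (\<Sum>j\<in>Nb l. sin (x t j - x t l)) + e) (at t)"
        using deriv[OF kl(2), of t] t t0 by auto
      have "\<sigma> * sin (x t j - x t l) \<le> 0" if "j \<in> Nb l" for j
      proof -
        have "j \<in> V" using that Nb_sub kl(2) by auto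
        then have "\<bar>x t j - \<mu>\<bar> \<le> \<rho>"
          using inside[of "(j, 1)"] inside[of "(j, -1)"] by (auto simp: f_def \<rho>_def)
        moreover have "\<sigma> * (x t l - \<mu>) = \<rho>" using hit kl by (simp add: f_def \<rho>_def)
        ultimately have "0 \<le> \<sigma> * (x t l - x t j)" "\<sigma> * (x t l - x t j) \<le> pi"
          using kl(3) \<rho> by auto
        then have "0 \<le> sin (\<sigma> * (x t l - x t j))" by (rule sin_ge_zero)
        also have "\<dots> = - (\<sigma> * sin (x t j - x t l))"
          using kl(3) by (auto simp flip: sin_minus)
        finally show ?thesis by simp
      qed
      then have "\<sigma> * (\<Sum>j\<in>Nb l. sin (x t j - x t l)) \<le> 0"
        unfolding sum_distrib_left by (rule sum_nonpos)
      moreover have "\<sigma> * e \<le> \<epsilon>" using e(1) kl(3) by auto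
      ultimately have "\<sigma> * ((\<Sum>j\<in>Nb l. sin (x t j - x t l)) + e) - (\<epsilon> + \<eta>) < 0"
        using \<eta> by (simp add: algebra_simps)
      moreover have "(f k has_real_derivative
          \<sigma> * ((\<Sum>j\<in>Nb l. sin (x t j - x t l)) + e) - (\<epsilon> + \<eta>)) (at t)"
        unfolding f_def kl using e(2) by (auto intro!: derivative_eq_intros)
      ultimately show "\<exists>d<0. (f k has_real_derivative d) (at t)" by blast
    qed
    show ?thesis
      using main[of "(i, 1)" "t0 + s"] main[of "(i, -1)" "t0 + s"] i s by (auto simp: f_def)
  qed
  show ?thesis
  proof (rule ccontr)
    assume above: "\<not> ?thesis"
    define g where "g = \<bar>x (t0 + s) i - \<mu>\<bar> - (R + \<epsilon> * s)"
    have "0 < g" using above by (simp add: g_def)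
    define \<eta> where "\<eta> = min (g / 2) ((pi - 2 * (R + \<epsilon>)) / 8)"
    have \<eta>: "0 < \<eta>" "\<eta> \<le> g / 2" "\<eta> < (pi - 2 * (R + \<epsilon>)) / 4"
      using \<open>0 < g\<close> R by (auto simp: \<eta>_def min_def)
    have "\<eta> * s \<le> \<eta>" using s \<eta>(1) by (simp add: mult_left_le)
    then show False using strict[OF \<eta>(1,3)] \<eta>(2) by (simp add: g_def algebra_simps)
  qed
qed

text \<open>
  Let \<open>y\<close> be the height above the lower end of the interval. This end recedes at speed \<open>\<epsilon>\<close>, so
  \<open>y \<ge> 0\<close> by \<open>confinement\<close>, and the recession makes up for the error term in \<open>y'\<close>. Every
  neighbor pulls \<open>i\<close> down at a rate of at most \<open>y i\<close>, and the predecessor \<open>j\<close> on the path contributes in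
  addition \<open>a * y j\<close> with \<open>a = sin b / b\<close>, so \<open>y' i \<ge> a * y j - n * y i\<close>. The
  integrating factor \<open>exp (n * s)\<close> turns this into \<open>z' i \<ge> a * z j\<close> for
  \<open>z = exp (n * s) * y\<close>. Starting from \<open>z r \<ge> R\<close> at the root, integrating once per arc
  gives the terms \<open>R * (a * s) ^ d / d!\<close> of the exponential series.
\<close>

lemma influence_spreads:
  assumes t0: "0 \<le> t0" and b: "2 * (R + \<epsilon>) \<le> b" "0 < b" "b < pi"
    and start: "\<And>i. i \<in> V \<Longrightarrow> \<bar>x t0 i - \<mu>\<bar> \<le> R"
    and root: "r \<in> V" "\<mu> \<le> x t0 r"
    and path: "(r, i) \<in> arcs V Nb ^^ d" and s: "0 \<le> s" "s \<le> 1"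
  shows "R * (sin b / b * s) ^ d / fact d
           \<le> exp (real (card V) * s) * (x (t0 + s) i - \<mu> + R + \<epsilon> * s)"
proof -
  define a where "a = sin b / b"
  define n where "n = real (card V)"
  define y where "y = (\<lambda>s i. x (t0 + s) i - \<mu> + R + \<epsilon> * s)"
  have a: "0 < a" "a \<le> 1" using b sin_gt_zero sin_x_le_x[of b] by (auto simp: a_def)
  have conf: "\<bar>x (t0 + s) i - \<mu>\<bar> \<le> R + \<epsilon> * s" if "0 \<le> s" "s \<le> 1" "i \<in> V" for s i
    using confinement[OF t0 _ start that] b by simp
  have ynn: "0 \<le> y s i" if "0 \<le> s" "s \<le> 1" "i \<in> V" for s i
    using conf[OF that] by (auto simp: y_def)
  have ycont: "continuous_on {0..1} (\<lambda>s. y s i)" if "i \<in> V" for i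
  proof -
    have "continuous_on {0..1} (\<lambda>s. x (t0 + s) i)"
      by (rule continuous_on_compose2[OF cont[OF that]]) (use t0 in \<open>auto intro!: continuous_intros\<close>)
    then show ?thesis unfolding y_def by (auto intro!: continuous_intros)
  qed
  \<comment> \<open>The two cases weigh a coupling term differently: the first bound is used for an arbitrary
      neighbor, the second for the predecessor on the path.\<close>
  have sin_lower: "- y s i \<le> sin (y s k - y s i) \<and> a * y s k - y s i \<le> sin (y s k - y s i)"
    if "0 \<le> s" "s \<le> 1" "i \<in> V" "k \<in> V" for s i k
  proof -
    have "\<epsilon> * s \<le> \<epsilon>" using that eps_nonneg by (simp add: mult_left_le)
    then have "\<bar>y s k - y s i\<bar> \<le> b"
      using conf[of s i] conf[of s k] that b by (auto simp: y_def)
    have "0 \<le> y s i" "0 \<le> y s k" using ynn that by auto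
    have ay: "a * y s i \<le> y s i" "a * y s k \<le> y s k"
      using a \<open>0 \<le> y s i\<close> \<open>0 \<le> y s k\<close> by (auto intro: mult_right_le_one_le mult_left_le_one_le)
    show ?thesis
    proof (cases "0 \<le> y s k - y s i")
      case True
      then have "a * (y s k - y s i) \<le> sin (y s k - y s i)"
        unfolding a_def using \<open>\<bar>y s k - y s i\<bar> \<le> b\<close> b by (intro sin_above_chord) auto
      moreover have "0 \<le> a * (y s k - y s i)" using True a by simp
      ultimately show ?thesis using ay \<open>0 \<le> y s i\<close> by (simp add: right_diff_distrib)
    next
      case False
      then have "y s k - y s i \<le> sin (y s k - y s i)"
        using sin_x_le_x[of "y s i - y s k"] sin_minus[of "y s i - y s k"] by simp
      then show ?thesis using ay \<open>0 \<le> y s k\<close> by simp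
    qed
  qed
  define z where "z = (\<lambda>s i. exp (n * s) * y s i)"
  have yderiv: "\<exists>D\<ge>(\<Sum>k\<in>Nb i. sin (y s k - y s i)). ((\<lambda>s. y s i) has_real_derivative D) (at s)"
    if si: "0 < s" "s < 1" "i \<in> V" for s i
  proof -
    obtain e where e: "\<bar>e\<bar> \<le> \<epsilon>" "((\<lambda>s. x s i) has_real_derivative
        (\<Sum>k\<in>Nb i. sin (x (t0 + s) k - x (t0 + s) i)) + e) (at (t0 + s))"
      using deriv[OF si(3), of "t0 + s"] t0 si by auto
    have "((\<lambda>s. x (t0 + s) i) has_real_derivative
        ((\<Sum>k\<in>Nb i. sin (x (t0 + s) k - x (t0 + s) i)) + e) * 1) (at s)"
      by (rule DERIV_chain2[where f = "\<lambda>s. x s i" and g = "\<lambda>s. t0 + s", OF e(2)])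
         (auto intro!: derivative_eq_intros)
    from DERIV_add[OF DERIV_add[OF DERIV_diff[OF this DERIV_const[of \<mu>]] DERIV_const[of R]]
        DERIV_cmult_Id[of \<epsilon>]]
    have "((\<lambda>s. y s i) has_real_derivative
        (\<Sum>k\<in>Nb i. sin (y s k - y s i)) + (e + \<epsilon>)) (at s)"
      by (simp add: y_def add.assoc)
    then show ?thesis using e(1) by (intro exI[of _ "(\<Sum>k\<in>Nb i. sin (y s k - y s i)) + (e + \<epsilon>)"]) auto
  qed
  have zderiv: "\<exists>D\<ge>exp (n * s) * (n * y s i + (\<Sum>k\<in>Nb i. sin (y s k - y s i))).
      ((\<lambda>s. z s i) has_real_derivative D) (at s)"
    if si: "0 < s" "s < 1" "i \<in> V" for s i
  proof -
    obtain D where D: "(\<Sum>k\<in>Nb i. sin (y s k - y s i)) \<le> D"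
      "((\<lambda>s. y s i) has_real_derivative D) (at s)" using yderiv[OF si] by blast
    have "((\<lambda>s. z s i) has_real_derivative exp (n * s) * (n * y s i + D)) (at s)"
    proof -
      have "((\<lambda>s. exp (n * s)) has_real_derivative exp (n * s) * n) (at s)"
        by (auto intro!: derivative_eq_intros)
      from DERIV_mult[OF this D(2)] show ?thesis by (simp add: z_def algebra_simps)
    qed
    moreover have "exp (n * s) * (n * y s i + (\<Sum>k\<in>Nb i. sin (y s k - y s i))) \<le> exp (n * s) * (n * y s i + D)"
      using D(1) by simp
    ultimately show ?thesis by blast
  qed
  have zcont: "continuous_on {0..1} (\<lambda>s. z s i)" if "i \<in> V" for i
    unfolding z_def using ycont[OF that] by (auto intro!: continuous_intros)
  have card_Nb: "real (card (Nb i)) \<le> n" if "i \<in> V" for i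
    unfolding n_def using card_mono[OF finite_V Nb_sub[OF that]] by simp
  have bound: "i \<in> V \<and> R * (a * s) ^ d / fact d \<le> z s i"
    if "(r, i) \<in> arcs V Nb ^^ d" "0 \<le> s" "s \<le> 1" for i d s
    using that
  proof (induction d arbitrary: i s)
    case 0
    have "z 0 r \<le> z s r"
    proof (rule DERIV_nonneg_imp_increasing_open[OF \<open>0 \<le> s\<close>])
      fix u assume u: "0 < u" "u < s"
      have "(\<Sum>k\<in>Nb r. - y u r) \<le> (\<Sum>k\<in>Nb r. sin (y u k - y u r))"
        using u 0 root Nb_sub[OF root(1)] by (intro sum_mono) (simp add: sin_lower subset_eq)
      moreover have "real (card (Nb r)) * y u r \<le> n * y u r"
        using card_Nb[OF root(1)] ynn u 0 root by (intro mult_right_mono) auto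
      ultimately have "0 \<le> exp (n * u) * (n * y u r + (\<Sum>k\<in>Nb r. sin (y u k - y u r)))"
        by simp
      moreover have "u < 1" using u(2) \<open>s \<le> 1\<close> by simp
      then obtain D where D: "exp (n * u) * (n * y u r + (\<Sum>k\<in>Nb r. sin (y u k - y u r))) \<le> D"
        "((\<lambda>s. z s r) has_real_derivative D) (at u)"
        using zderiv[OF u(1) _ root(1)] by blast
      ultimately have "0 \<le> D" by linarith
      then show "\<exists>D. ((\<lambda>s. z s r) has_real_derivative D) (at u) \<and> 0 \<le> D"
        using D(2) by blast
    next
      show "continuous_on {0..s} (\<lambda>s. z s r)"
        using zcont[OF root(1)] by (rule continuous_on_subset) (use 0 in auto)
    qed
    moreover have "R \<le> z 0 r" using root by (simp add: z_def y_def)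
    ultimately show ?case using 0 root by auto
  next
    case (Suc d)
    then obtain j where j: "(r, j) \<in> arcs V Nb ^^ d" "i \<in> V" "j \<in> Nb i"
      by (auto simp: arcs_def)
    define w where "w = (\<lambda>s. z s i - R * (a * s) ^ Suc d / fact (Suc d))"
    have "w 0 \<le> w s"
    proof (rule DERIV_nonneg_imp_increasing_open[OF \<open>0 \<le> s\<close>])
      fix u assume u: "0 < u" "u < s"
      have u1: "0 \<le> u" "u \<le> 1" "u < 1" using u \<open>s \<le> 1\<close> by simp_all
      have finN: "finite (Nb i)" using finite_subset[OF Nb_sub finite_V] j by auto
      have "(\<Sum>k\<in>Nb i. (if k = j then a * y u j else 0) - y u i) \<le> (\<Sum>k\<in>Nb i. sin (y u k - y u i))"
        using sin_lower[OF u1(1,2) j(2)] Nb_sub[OF j(2)] by (intro sum_mono) auto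
      moreover have "real (card (Nb i)) * y u i \<le> n * y u i"
        using card_Nb[OF j(2)] ynn u1 j by (intro mult_right_mono) auto
      ultimately have "a * y u j \<le> n * y u i + (\<Sum>k\<in>Nb i. sin (y u k - y u i))"
        using finN j(3) by (simp add: sum_subtractf)
      then have "exp (n * u) * (a * y u j) \<le> exp (n * u) * (n * y u i + (\<Sum>k\<in>Nb i. sin (y u k - y u i)))"
        by (rule mult_left_mono) simp
      then have "a * z u j \<le> exp (n * u) * (n * y u i + (\<Sum>k\<in>Nb i. sin (y u k - y u i)))"
        by (simp only: z_def mult.left_commute)
      moreover have "a * (R * (a * u) ^ d / fact d) \<le> a * z u j"
        using Suc.IH[OF j(1) u1(1,2)] a by (intro mult_left_mono) auto
      moreover obtain D where D: "exp (n * u) * (n * y u i + (\<Sum>k\<in>Nb i. sin (y u k - y u i))) \<le> D"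
        "((\<lambda>s. z s i) has_real_derivative D) (at u)"
        using zderiv[OF u(1) u1(3) j(2)] by blast
      ultimately have "0 \<le> D - a * (R * (a * u) ^ d / fact d)" by simp
      moreover have "(w has_real_derivative D - a * (R * (a * u) ^ d / fact d)) (at u)"
      proof -
        have "((\<lambda>s. R * (a * s) ^ Suc d / fact (Suc d)) has_real_derivative
            R * (real (Suc d) * (a * u) ^ d * a) / fact (Suc d)) (at u)"
          by (rule derivative_eq_intros refl | simp)+
        moreover have "R * (real (Suc d) * (a * u) ^ d * a) / fact (Suc d) = a * (R * (a * u) ^ d / fact d)"
          by (simp add: divide_simps del: of_nat_Suc)
        ultimately have "((\<lambda>s. R * (a * s) ^ Suc d / fact (Suc d)) has_real_derivative
            a * (R * (a * u) ^ d / fact d)) (at u)" by (simp only:)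
        from DERIV_diff[OF D(2) this] show ?thesis unfolding w_def .
      qed
      ultimately show "\<exists>D. (w has_real_derivative D) (at u) \<and> 0 \<le> D" by blast
    next
      have "continuous_on {0..s} (\<lambda>s. z s i)"
        using zcont[OF j(2)] by (rule continuous_on_subset) (use Suc in auto)
      then show "continuous_on {0..s} w" unfolding w_def by (auto intro!: continuous_intros)
    qed
    moreover have "0 \<le> w 0" using ynn[of 0 i] j by (simp add: w_def z_def)
    ultimately show ?case using j by (simp add: w_def)
  qed
  show ?thesis using bound[OF path s] by (simp add: z_def y_def a_def n_def)
qed

text \<open>
  The lower end rises by \<open>2 * c * R - \<epsilon>\<close> while the upper end rises by at most \<open>\<epsilon>\<close>, so the new
  center is \<open>\<mu> + c * R\<close>. The lift along a path of length \<open>d \<le> L\<close> is at least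
  the one computed for length \<open>L\<close>, because \<open>sin b / b \<le> 1\<close>.
\<close>

lemma contraction_step_upper:
  assumes t0: "0 \<le> t0" and b: "2 * (R + \<epsilon>) \<le> b" "0 < b" "b < pi" and R0: "0 \<le> R"
    and start: "\<And>i. i \<in> V \<Longrightarrow> \<bar>x t0 i - \<mu>\<bar> \<le> R"
    and root: "r \<in> V" "\<mu> \<le> x t0 r"
    and reach: "\<And>i. i \<in> V \<Longrightarrow> \<exists>d\<le>L. (r, i) \<in> arcs V Nb ^^ d"
    and i: "i \<in> V"
  shows "\<bar>x (t0 + 1) i - (\<mu> + contraction_rate (card V) b L * R)\<bar> \<le> (1 - contraction_rate (card V) b L) * R + \<epsilon>"
proof -
  define a where "a = sin b / b"
  define c where "c = contraction_rate (card V) b L"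
  have a: "0 < a" "a \<le> 1" using b sin_gt_zero sin_x_le_x[of b] by (auto simp: a_def)
  obtain d where d: "d \<le> L" "(r, i) \<in> arcs V Nb ^^ d" using reach[OF i] by auto
  have "a ^ L / fact L \<le> a ^ d / fact d"
    using a d by (intro frac_le power_decreasing fact_mono) auto
  then have "R * (a ^ L / fact L) \<le> R * (a ^ d / fact d)"
    using R0 by (rule mult_left_mono)
  also have "\<dots> \<le> exp (real (card V)) * (x (t0 + 1) i - \<mu> + R + \<epsilon>)"
    using influence_spreads[OF t0 b start root d(2), of 1] by (simp add: a_def)
  finally have "exp (- real (card V)) * (R * (a ^ L / fact L)) \<le>
      exp (- real (card V)) * (exp (real (card V)) * (x (t0 + 1) i - \<mu> + R + \<epsilon>))"
    by (rule mult_left_mono) simp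
  also have "\<dots> = x (t0 + 1) i - \<mu> + R + \<epsilon>"
    by (simp flip: mult.assoc exp_add)
  finally have "2 * (c * R) \<le> x (t0 + 1) i - \<mu> + R + \<epsilon>"
    by (simp add: c_def contraction_rate_def a_def mult.commute mult.left_commute)
  moreover have "\<bar>x (t0 + 1) i - \<mu>\<bar> \<le> R + \<epsilon> * 1"
    using confinement[OF t0 _ start, of 1 i] b i by auto
  moreover have "0 \<le> c * R" using contraction_rate_bounds[OF b(2,3)] R0 by (simp add: c_def less_imp_le)
  ultimately show ?thesis by (auto simp: c_def[symmetric] algebra_simps abs_le_iff)
qed

text \<open>A root in the lower half is moved to the upper half by reflecting all phases.\<close>

lemma contraction_step:
  assumes t0: "0 \<le> t0" and b: "2 * (R + \<epsilon>) \<le> b" "0 < b" "b < pi" and R0: "0 \<le> R"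
    and start: "\<And>i. i \<in> V \<Longrightarrow> \<bar>x t0 i - \<mu>\<bar> \<le> R"
    and root: "r \<in> V"
    and reach: "\<And>i. i \<in> V \<Longrightarrow> \<exists>d\<le>L. (r, i) \<in> arcs V Nb ^^ d"
  shows "\<exists>\<mu>'. \<forall>i\<in>V. \<bar>x (t0 + 1) i - \<mu>'\<bar> \<le> (1 - contraction_rate (card V) b L) * R + \<epsilon>"
proof (cases "\<mu> \<le> x t0 r")
  case True
  then show ?thesis using contraction_step_upper[OF t0 b R0 start root _ reach] by blast
next
  case False
  interpret refl: perturbed_flow V Nb \<epsilon> "\<lambda>t i. - x t i" by (rule reflected)
  have "\<bar>- x (t0 + 1) i - (- \<mu> + contraction_rate (card V) b L * R)\<bar> \<le> (1 - contraction_rate (card V) b L) * R + \<epsilon>"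
    if "i \<in> V" for i
    using refl.contraction_step_upper[OF t0 b R0 _ root _ reach that, of "- \<mu>"] start False
    by (simp add: abs_minus_commute)
  then have "\<forall>i\<in>V. \<bar>x (t0 + 1) i - (\<mu> - contraction_rate (card V) b L * R)\<bar> \<le> (1 - contraction_rate (card V) b L) * R + \<epsilon>"
    by (smt (verit))
  then show ?thesis by blast
qed

text \<open>
  The map \<open>\<rho> \<mapsto> (1 - c) * \<rho> + \<epsilon>\<close> preserves \<open>\<rho> \<le> R\<close> by the hypothesis \<open>\<epsilon> \<le> c * R\<close>, and after
  \<open>n\<close> steps it gives at most \<open>(1 - c) ^ n * R + \<delta>\<close>, because its fixed point
  \<open>\<epsilon> / c\<close> is at most \<open>\<delta>\<close>. Of the final \<open>3 * \<delta>\<close>, one \<open>\<delta>\<close> bounds this fixed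
  point, one the geometric term, and one the growth between integer times.
\<close>

lemma eventually_confined:
  assumes b: "0 < b" "b < pi" and R0: "2 * (R + \<epsilon>) \<le> b" "\<epsilon> \<le> contraction_rate (card V) b L * R"
    and \<delta>: "0 < \<delta>" "\<epsilon> \<le> contraction_rate (card V) b L * \<delta>"
    and start: "\<And>i. i \<in> V \<Longrightarrow> \<bar>x 0 i - \<mu>\<bar> \<le> R"
    and root: "r \<in> V"
    and reach: "\<And>i. i \<in> V \<Longrightarrow> \<exists>d\<le>L. (r, i) \<in> arcs V Nb ^^ d"
  shows "\<exists>T\<ge>0. \<forall>s\<ge>T. \<exists>\<mu>. \<forall>i\<in>V. \<bar>x s i - \<mu>\<bar> \<le> 3 * \<delta>"
proof -
  define c where "c = contraction_rate (card V) b L"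
  have c: "0 < c" "c < 1" using contraction_rate_bounds[OF b] by (auto simp: c_def)
  have "0 \<le> c * R" using R0(2) eps_nonneg by (simp add: c_def)
  then have R: "0 \<le> R" using c by (simp add: zero_le_mult_iff)
  have step: "\<exists>\<mu> \<rho>. 0 \<le> \<rho> \<and> \<rho> \<le> R \<and> \<rho> \<le> (1 - c) ^ n * R + \<delta> \<and> (\<forall>i\<in>V. \<bar>x (real n) i - \<mu>\<bar> \<le> \<rho>)" for n
  proof (induction n)
    case 0
    show ?case using start R \<delta> by (intro exI[of _ \<mu>] exI[of _ R]) auto
  next
    case (Suc n)
    then obtain \<mu> \<rho> where IH: "0 \<le> \<rho>" "\<rho> \<le> R" "\<rho> \<le> (1 - c) ^ n * R + \<delta>"
      "\<forall>i\<in>V. \<bar>x (real n) i - \<mu>\<bar> \<le> \<rho>" by blast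
    have "\<exists>\<mu>'. \<forall>i\<in>V. \<bar>x (real n + 1) i - \<mu>'\<bar> \<le> (1 - c) * \<rho> + \<epsilon>"
      unfolding c_def using IH R0 b by (intro contraction_step[OF _ _ _ _ _ _ root reach]) auto
    then obtain \<mu>' where "\<forall>i\<in>V. \<bar>x (real n + 1) i - \<mu>'\<bar> \<le> (1 - c) * \<rho> + \<epsilon>"
      by blast
    then have "\<forall>i\<in>V. \<bar>x (real (Suc n)) i - \<mu>'\<bar> \<le> (1 - c) * \<rho> + \<epsilon>"
      by (simp add: add.commute)
    moreover have "0 \<le> (1 - c) * \<rho> + \<epsilon>" using IH c eps_nonneg by simp
    moreover have "(1 - c) * \<rho> \<le> (1 - c) * R" "(1 - c) * \<rho> \<le> (1 - c) * ((1 - c) ^ n * R + \<delta>)"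
      using IH c by (auto intro!: mult_left_mono)
    moreover have "(1 - c) * R + \<epsilon> \<le> R"
      "(1 - c) * ((1 - c) ^ n * R + \<delta>) + \<epsilon> \<le> (1 - c) ^ Suc n * R + \<delta>"
      using R0(2) \<delta>(2) unfolding c_def[symmetric] by (simp_all add: algebra_simps)
    ultimately have "0 \<le> (1 - c) * \<rho> + \<epsilon> \<and> (1 - c) * \<rho> + \<epsilon> \<le> R \<and>
        (1 - c) * \<rho> + \<epsilon> \<le> (1 - c) ^ Suc n * R + \<delta> \<and>
        (\<forall>i\<in>V. \<bar>x (real (Suc n)) i - \<mu>'\<bar> \<le> (1 - c) * \<rho> + \<epsilon>)" by linarith
    then show ?case by blast
  qed
  have "(\<lambda>n. (1 - c) ^ n * R) \<longlonglongrightarrow> 0 * R"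
    using c by (intro tendsto_intros LIMSEQ_realpow_zero) auto
  then have "eventually (\<lambda>n. (1 - c) ^ n * R < \<delta>) sequentially"
    using \<delta>(1) by (intro order_tendstoD(2)) auto
  then obtain k where k: "\<And>n. n \<ge> k \<Longrightarrow> (1 - c) ^ n * R < \<delta>"
    by (auto simp: eventually_sequentially)
  have "c * \<delta> \<le> \<delta>" using \<delta>(1) c by (simp add: mult_left_le_one_le)
  then have "\<epsilon> \<le> \<delta>" using \<delta>(2) by (simp add: c_def)
  have "\<exists>\<mu>. \<forall>i\<in>V. \<bar>x s i - \<mu>\<bar> \<le> 3 * \<delta>" if s: "s \<ge> real k" for s
  proof -
    define n where "n = nat \<lfloor>s\<rfloor>"
    have n: "n \<ge> k" "real n \<le> s" "s - real n \<le> 1" using s unfolding n_def by linarith+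
    obtain \<mu> \<rho> where \<mu>: "\<rho> \<le> R" "\<rho> \<le> (1 - c) ^ n * R + \<delta>" "\<forall>i\<in>V. \<bar>x (real n) i - \<mu>\<bar> \<le> \<rho>"
      using step by blast
    have "\<bar>x s i - \<mu>\<bar> \<le> 3 * \<delta>" if "i \<in> V" for i
    proof -
      have "\<bar>x (real n + (s - real n)) i - \<mu>\<bar> \<le> \<rho> + \<epsilon> * (s - real n)"
        using \<mu> R0 b n that by (intro confinement) auto
      moreover have "\<epsilon> * (s - real n) \<le> \<epsilon>" using eps_nonneg n by (simp add: mult_left_le)
      ultimately show ?thesis using \<mu>(2) k[OF n(1)] \<open>\<epsilon> \<le> \<delta>\<close> by simp
    qed
    then show ?thesis by blast
  qed
  then show ?thesis by (intro exI[of _ "real k"]) auto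
qed

end

section \<open>The Kuramoto model\<close>

lemma is_path_imp_rtrancl:
  "is_path N Nb p \<Longrightarrow> (hd p, last p) \<in> (arcs {1..N} Nb)\<^sup>*"
proof (induction p)
  case (Cons v p)
  show ?case
  proof (cases p)
    case (Cons w q)
    have "is_path N Nb p" "v \<in> Nb w" "w \<in> {1..N}"
      using Cons.prems Cons by (auto simp: is_path_def)
    then show ?thesis using Cons.IH Cons by (auto simp: arcs_def intro: converse_rtrancl_into_rtrancl)
  qed simp
qed (simp add: is_path_def)

lemma spanning_tree_bounded_depth:
  assumes "contains_spanning_tree N Nb"
  obtains r L where "r \<in> {1..N}"
    "\<And>i. i \<in> {1..N} \<Longrightarrow> \<exists>d\<le>L. (r, i) \<in> arcs {1..N} Nb ^^ d"
proof -
  obtain r where r: "r \<in> {1..N}" "\<And>i. i \<in> {1..N} - {r} \<Longrightarrow> reachable_from N Nb r i"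
    using assms by (auto simp: contains_spanning_tree_def)
  have "\<exists>d. (r, i) \<in> arcs {1..N} Nb ^^ d" if "i \<in> {1..N}" for i
  proof (cases "i = r")
    case True
    then show ?thesis by (intro exI[of _ 0]) simp
  next
    case False
    then show ?thesis using r(2)[of i] that
      by (auto simp: reachable_from_def dest!: is_path_imp_rtrancl intro: rtrancl_imp_relpow)
  qed
  then obtain d where d: "\<And>i. i \<in> {1..N} \<Longrightarrow> (r, i) \<in> arcs {1..N} Nb ^^ d i"
    by metis
  show thesis
  proof (rule that[OF r(1)])
    fix i assume "i \<in> {1..N}"
    then show "\<exists>e\<le>Max (d ` {1..N}). (r, i) \<in> arcs {1..N} Nb ^^ e"
      using d by (intro exI[of _ "d i"]) auto
  qed
qed

lemma phase_diameter_le: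
  assumes "1 \<le> N" "\<And>i. i \<in> {1..N} \<Longrightarrow> \<bar>x i - \<mu>\<bar> \<le> R"
  shows "phase_diameter N x \<le> 2 * R"
proof -
  have "Max (x ` {1..N}) \<le> \<mu> + R" using assms by (subst Max_le_iff) (auto simp: abs_le_iff algebra_simps)
  moreover have "\<mu> - R \<le> Min (x ` {1..N})" using assms by (subst Min_ge_iff) (force simp: abs_le_iff)+
  ultimately show ?thesis by (simp add: phase_diameter_def)
qed

lemma phase_diameter_center:
  assumes "i \<in> {1..N}"
  shows "\<bar>x i - (Max (x ` {1..N}) + Min (x ` {1..N})) / 2\<bar> \<le> phase_diameter N x / 2"
proof -
  have "x i \<le> Max (x ` {1..N})" "Min (x ` {1..N}) \<le> x i" using assms by auto
  then show ?thesis by (simp add: phase_diameter_def abs_le_iff field_simps)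
qed

text \<open>
  The error at \<open>i\<close> is \<open>\<Omega> i / K\<close> plus the effect of the frustration, which is at most \<open>\<alpha>\<close> for
  each of the at most \<open>N\<close> neighbors.
\<close>

lemma kuramoto_rescaled:
  assumes sol: "kuramoto_solution N Nb \<Omega> \<theta>0 K \<alpha> \<theta>"
    and Nb: "\<And>i. i \<in> {1..N} \<Longrightarrow> Nb i \<subseteq> {1..N}"
    and K: "0 < K" and \<alpha>: "0 \<le> \<alpha>"
    and small: "(\<Sum>i=1..N. \<bar>\<Omega> i\<bar>) / K + real N * \<alpha> \<le> \<epsilon>"
  shows "perturbed_flow {1..N} Nb \<epsilon> (\<lambda>s. \<theta> (s / K))"
proof
  show "0 \<le> \<epsilon>" using small K \<alpha> by (smt (verit) divide_nonneg_pos mult_nonneg_nonneg of_nat_0_le_iff sum_nonneg abs_ge_zero)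
  fix i assume i: "i \<in> {1..N}"
  show "Nb i \<subseteq> {1..N}" using Nb i by simp
  have ci: "continuous_on {0..} (\<lambda>t. \<theta> t i)" using sol i by (simp add: kuramoto_solution_def)
  show "continuous_on {0..} (\<lambda>s. \<theta> (s / K) i)"
    by (rule continuous_on_compose2[OF ci]) (use K in \<open>auto intro!: continuous_intros\<close>)
  fix s :: real assume s: "0 < s"
  define t where "t = s / K"
  have "0 < t" using s K by (simp add: t_def)
  then have "((\<lambda>s. \<theta> s i) has_real_derivative
       \<Omega> i + K * (\<Sum>j\<in>Nb i. sin (\<theta> t j - \<theta> t i + \<alpha>))) (at (s / K))"
    using sol i unfolding t_def by (simp add: kuramoto_solution_def)
  then have D: "((\<lambda>s. \<theta> (s / K) i) has_real_derivative
       (\<Omega> i + K * (\<Sum>j\<in>Nb i. sin (\<theta> t j - \<theta> t i + \<alpha>))) * (1 / K)) (at s)"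
    by (rule DERIV_chain2) (use K in \<open>auto intro!: derivative_eq_intros\<close>)
  define e where "e = \<Omega> i / K + (\<Sum>j\<in>Nb i. sin (\<theta> t j - \<theta> t i + \<alpha>) - sin (\<theta> t j - \<theta> t i))"
  have "\<bar>\<Omega> i\<bar> \<le> (\<Sum>i=1..N. \<bar>\<Omega> i\<bar>)" using i by (intro member_le_sum) auto
  then have "\<bar>\<Omega> i / K\<bar> \<le> (\<Sum>i=1..N. \<bar>\<Omega> i\<bar>) / K" using K by (simp add: divide_right_mono)
  moreover have "\<bar>\<Sum>j\<in>Nb i. sin (\<theta> t j - \<theta> t i + \<alpha>) - sin (\<theta> t j - \<theta> t i)\<bar> \<le> real (card (Nb i)) * \<alpha>"
    using abs_sin_shift_le[of _ \<alpha>] \<alpha>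
    by (intro order_trans[OF sum_abs] order_trans[OF sum_bounded_above[of _ _ \<alpha>]]) auto
  moreover have "real (card (Nb i)) * \<alpha> \<le> real N * \<alpha>"
    using card_mono[OF _ Nb[OF i]] \<alpha> by (intro mult_right_mono) auto
  ultimately have "\<bar>e\<bar> \<le> \<epsilon>" using small unfolding e_def by linarith
  moreover have "(\<Omega> i + K * (\<Sum>j\<in>Nb i. sin (\<theta> t j - \<theta> t i + \<alpha>))) * (1 / K) =
      (\<Sum>j\<in>Nb i. sin (\<theta> t j - \<theta> t i)) + e"
    using K by (simp add: e_def sum_subtractf field_simps)
  ultimately show "\<exists>e. \<bar>e\<bar> \<le> \<epsilon> \<and> ((\<lambda>s. \<theta> (s / K) i) has_real_derivative
      (\<Sum>j\<in>Nb i. sin (\<theta> (s / K) j - \<theta> (s / K) i)) + e) (at s)"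
    using D unfolding t_def by auto
qed simp

theorem theorem1p1:
  fixes N :: nat and Nb :: "nat \<Rightarrow> nat set"
    and \<Omega> \<theta>0 :: "nat \<Rightarrow> real" and Dinf :: real
  assumes "N \<ge> 1"
    and "\<And>i. i \<in> {1..N} \<Longrightarrow> Nb i \<subseteq> {1..N}"
    and "contains_spanning_tree N Nb"
    and "phase_diameter N \<theta>0 < pi"
    and "0 < Dinf" and "Dinf < pi / 2"
  shows "\<exists>K0>0. \<exists>\<alpha>0. 0 < \<alpha>0 \<and> \<alpha>0 < pi / 2 \<and>
           (\<forall>K>K0. \<forall>\<alpha>. 0 < \<alpha> \<and> \<alpha> < \<alpha>0 \<longrightarrow>
              (\<forall>\<theta>. kuramoto_solution N Nb \<Omega> \<theta>0 K \<alpha> \<theta> \<longrightarrow>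
                 (\<exists>tstar>0. \<forall>t\<ge>tstar. phase_diameter N (\<theta> t) \<le> Dinf)))"
proof -
  obtain r L where r: "r \<in> {1..N}"
    and reach: "\<And>i. i \<in> {1..N} \<Longrightarrow> \<exists>d\<le>L. (r, i) \<in> arcs {1..N} Nb ^^ d"
    using spanning_tree_bounded_depth[OF assms(3)] by blast
  \<comment> \<open>The final radius \<open>3 * \<delta>\<close> corresponds to the diameter \<open>Dinf\<close>.\<close>
  define \<delta> where "\<delta> = Dinf / 6"
  \<comment> \<open>The maximum ensures \<open>\<epsilon> \<le> c * R\<close> even if the initial phases are very close together.\<close>
  define R where "R = max (phase_diameter N \<theta>0 / 2) \<delta>"
  \<comment> \<open>Halfway between the initial diameter bound \<open>2 * R\<close> and \<open>pi\<close>.\<close>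
  define b where "b = R + pi / 2"
  have R: "0 < R" "R < pi / 2" "phase_diameter N \<theta>0 / 2 \<le> R" "\<delta> \<le> R"
    using assms(4-6) by (auto simp: R_def \<delta>_def)
  then have b: "0 < b" "b < pi" by (auto simp: b_def)
  define c where "c = contraction_rate N b L"
  have c: "0 < c" using contraction_rate_bounds[OF b] by (simp add: c_def)
  \<comment> \<open>The first bound makes \<open>2 * (R + \<epsilon>) \<le> b\<close>.\<close>
  define \<epsilon> where "\<epsilon> = min ((pi / 2 - R) / 2) (c * \<delta>)"
  have \<epsilon>: "0 < \<epsilon>" "2 * (R + \<epsilon>) \<le> b" "\<epsilon> \<le> c * \<delta>"
    using R c assms(5) by (auto simp: \<epsilon>_def b_def \<delta>_def min_def field_simps)
  have "c * \<delta> \<le> c * R" using R(4) c by simp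
  then have "\<epsilon> \<le> c * R" using \<epsilon>(3) by linarith
  define W where "W = (\<Sum>i=1..N. \<bar>\<Omega> i\<bar>)"
  have "0 \<le> W" unfolding W_def by (intro sum_nonneg) auto
  define K0 where "K0 = 2 * (W + 1) / \<epsilon>"
  define \<alpha>0 where "\<alpha>0 = min 1 (\<epsilon> / (2 * real N))"
  have "\<exists>tstar>0. \<forall>t\<ge>tstar. phase_diameter N (\<theta> t) \<le> Dinf"
    if K: "K0 < K" and \<alpha>: "0 < \<alpha>" "\<alpha> < \<alpha>0" and sol: "kuramoto_solution N Nb \<Omega> \<theta>0 K \<alpha> \<theta>" for K \<alpha> \<theta>
  proof -
    have "0 < K0" using \<open>0 \<le> W\<close> \<epsilon> by (simp add: K0_def)
    then have "0 < K" using K by simp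
    have "2 * (W + 1) < \<epsilon> * K" using K \<epsilon> by (simp add: K0_def field_simps)
    then have "W / K \<le> \<epsilon> / 2" using \<open>0 < K\<close> by (simp add: field_simps)
    moreover have "real N * \<alpha> \<le> \<epsilon> / 2" using \<alpha> assms(1) by (simp add: \<alpha>0_def field_simps)
    ultimately have small: "W / K + real N * \<alpha> \<le> \<epsilon>" by linarith
    interpret perturbed_flow "{1..N}" Nb \<epsilon> "\<lambda>s. \<theta> (s / K)"
      using kuramoto_rescaled[OF sol assms(2) \<open>0 < K\<close>] \<alpha> small by (simp add: W_def)
    have "\<theta> 0 i = \<theta>0 i" if "i \<in> {1..N}" for i using sol that by (simp add: kuramoto_solution_def)
    then have start: "\<bar>\<theta> (0 / K) i - (Max (\<theta>0 ` {1..N}) + Min (\<theta>0 ` {1..N})) / 2\<bar> \<le> R" if "i \<in> {1..N}" for i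
      using phase_diameter_center[OF that, of \<theta>0] R(3) that by simp
    have "\<exists>T\<ge>0. \<forall>s\<ge>T. \<exists>\<mu>. \<forall>i\<in>{1..N}. \<bar>\<theta> (s / K) i - \<mu>\<bar> \<le> 3 * \<delta>"
      by (rule eventually_confined[OF b \<epsilon>(2) _ _ _ start r])
         (use \<epsilon> \<open>\<epsilon> \<le> c * R\<close> assms(5) reach in \<open>auto simp: c_def \<delta>_def\<close>)
    then obtain T where T: "0 \<le> T" "\<And>s. T \<le> s \<Longrightarrow> \<exists>\<mu>. \<forall>i\<in>{1..N}. \<bar>\<theta> (s / K) i - \<mu>\<bar> \<le> 3 * \<delta>"
      by blast
    \<comment> \<open>Adding \<open>1\<close> makes the time positive even if \<open>T = 0\<close>.\<close>
    have "phase_diameter N (\<theta> t) \<le> Dinf" if t: "(T + 1) / K \<le> t" for t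
    proof -
      have "T \<le> t * K" using t \<open>0 < K\<close> by (simp add: field_simps)
      then obtain \<mu> where "\<forall>i\<in>{1..N}. \<bar>\<theta> t i - \<mu>\<bar> \<le> 3 * \<delta>"
        using T(2)[of "t * K"] \<open>0 < K\<close> by auto
      then have "phase_diameter N (\<theta> t) \<le> 2 * (3 * \<delta>)"
        using assms(1) by (intro phase_diameter_le) auto
      then show ?thesis by (simp add: \<delta>_def)
    qed
    moreover have "0 < (T + 1) / K" using T(1) \<open>0 < K\<close> by simp
    ultimately show ?thesis by blast
  qed
  moreover have "0 < K0" using \<open>0 \<le> W\<close> \<epsilon> by (simp add: K0_def)
  moreover have "0 < \<alpha>0" "\<alpha>0 < pi / 2" using \<epsilon> assms(1) pi_gt3 by (auto simp: \<alpha>0_def)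
  ultimately show ?thesis by blast
qed

end
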